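(* Let $L,V,\mu>0$ and let $Q:\mathbb{R}\to[0,\infty)$ be non-decreasing and left-continuous with $Q(t)=0$ for $t<0$. Put $$\overline U(t)=\inf_{\tau\le t}\{Q(\tau)+\mu(t-\tau)\}.$$ Let $g(u)=u/V$ for $u\in[0,\mu]$, and let $U(t,x)$ be the viscosity solution of $$\partial_x U(t,x)+g\big(\partial_t U(t,x)\big)=0,\qquad U(t,0)=\overline U(t).$$ Then for $t>0$ and $0<x\le L$, $$U(t,x)=\inf_{\tau\in\mathbb{R}}\Big\{x\,g^*\Big(\frac{t-\tau}{x}\Big)+\overline U(\tau)\Big\}=\inf_{\tau\in\mathbb{R}}\Big\{x\,g^*\Big(\frac{t-\tau}{x}\Big)+Q(\tau)\Big\},$$ where $g^*$ is the Legendre transform of $g$, $$g^*(q)=\sup_{p\in[0,\mu]}\{qp-g(p)\}=\begin{cases}0, & q\le \frac1V,\\ \big(q-\frac1V\big)\mu, & q>\frac1V.\end{cases}$$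
   Context: A processor is represented by the spatial interval $[0,L]$; it has constant processing speed $V$ and flow capacity $\mu$, and a buffer queue located at $x=0$. $Q(t)$ is the cumulative number of products that have arrived at the queue by time $t$, $\overline U(t)$ is the cumulative number released from the queue into the processor by time $t$, and $U(t,x)$ is the cumulative number of products that have passed location $x$ by time $t$. In the Hamilton-Jacobi equation the variable $x\ge 0$ plays the role of "time" and $t$ the role of "space", so the condition at $x=0$ is an initial condition, posed for $t\in\mathbb{R}$. The Hamiltonian $g$ is defined only on $[0,\mu]$ (flows lie between $0$ and the capacity $\mu$), so the viscosity solution is understood among functions that are non-decreasing and $\mu$-Lipschitz in $t$. *)

theory Defs
  imports "HOL-Analysis.Analysis"
begin

text \<open>Cumulative number of products released from the buffer queue, given the cumulative
  arrivals \<open>Q\<close>. The infimum is over a set bounded below whenever \<open>Q \<ge> 0\<close> and \<open>\<mu> \<ge> 0\<close>.\<close>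

definition released :: "real \<Rightarrow> (real \<Rightarrow> real) \<Rightarrow> real \<Rightarrow> real" where
  "released \<mu> Q t = (INF \<tau>\<in>{..t}. Q \<tau> + \<mu> * (t - \<tau>))"

definition legendre :: "real set \<Rightarrow> (real \<Rightarrow> real) \<Rightarrow> real \<Rightarrow> real" where
  "legendre D g q = (SUP p\<in>D. q * p - g p)"

text \<open>Points of the domain are pairs \<open>(t, x)\<close>. A \<open>C\<^sup>1\<close> test function is given together with its
  partial derivatives \<open>\<phi>\<^sub>t\<close> and \<open>\<phi>\<^sub>x\<close>.\<close>

definition C1_test ::
  "(real \<times> real \<Rightarrow> real) \<Rightarrow> (real \<times> real \<Rightarrow> real) \<Rightarrow> (real \<times> real \<Rightarrow> real) \<Rightarrow> bool" where
  "C1_test \<phi> \<phi>\<^sub>t \<phi>\<^sub>x \<longleftrightarrow>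
     continuous_on UNIV \<phi>\<^sub>t \<and> continuous_on UNIV \<phi>\<^sub>x \<and>
     (\<forall>z. (\<phi> has_derivative (\<lambda>h. \<phi>\<^sub>t z * fst h + \<phi>\<^sub>x z * snd h)) (at z))"

definition viscosity_subsolution ::
  "real \<Rightarrow> (real \<Rightarrow> real) \<Rightarrow> (real \<Rightarrow> real \<Rightarrow> real) \<Rightarrow> bool" where
  "viscosity_subsolution L g U \<longleftrightarrow>
     (\<forall>\<phi> \<phi>\<^sub>t \<phi>\<^sub>x t\<^sub>0 x\<^sub>0. C1_test \<phi> \<phi>\<^sub>t \<phi>\<^sub>x \<and> 0 < x\<^sub>0 \<and> x\<^sub>0 < L \<and>
        (\<forall>\<^sub>F (t, x) in nhds (t\<^sub>0, x\<^sub>0). U t x - \<phi> (t, x) \<le> U t\<^sub>0 x\<^sub>0 - \<phi> (t\<^sub>0, x\<^sub>0)) \<longrightarrow>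
        \<phi>\<^sub>x (t\<^sub>0, x\<^sub>0) + g (\<phi>\<^sub>t (t\<^sub>0, x\<^sub>0)) \<le> 0)"

definition viscosity_supersolution ::
  "real \<Rightarrow> (real \<Rightarrow> real) \<Rightarrow> (real \<Rightarrow> real \<Rightarrow> real) \<Rightarrow> bool" where
  "viscosity_supersolution L g U \<longleftrightarrow>
     (\<forall>\<phi> \<phi>\<^sub>t \<phi>\<^sub>x t\<^sub>0 x\<^sub>0. C1_test \<phi> \<phi>\<^sub>t \<phi>\<^sub>x \<and> 0 < x\<^sub>0 \<and> x\<^sub>0 < L \<and>
        (\<forall>\<^sub>F (t, x) in nhds (t\<^sub>0, x\<^sub>0). U t x - \<phi> (t, x) \<ge> U t\<^sub>0 x\<^sub>0 - \<phi> (t\<^sub>0, x\<^sub>0)) \<longrightarrow>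
        \<phi>\<^sub>x (t\<^sub>0, x\<^sub>0) + g (\<phi>\<^sub>t (t\<^sub>0, x\<^sub>0)) \<ge> 0)"

text \<open>Viscosity solutions of \<open>\<partial>\<^sub>x U + g (\<partial>\<^sub>t U) = 0\<close>, \<open>U(t,0) = u\<^sub>0(t)\<close>, for \<open>t \<in> \<real>\<close>, \<open>0 \<le> x \<le> L\<close>,
  with \<open>x\<close> as the evolution variable. Only the values of \<open>g\<close> on \<open>[0,\<mu>]\<close> matter: since \<open>U\<close> is
  non-decreasing and \<open>\<mu>\<close>-Lipschitz in \<open>t\<close>, every test function touching \<open>U\<close> from above or
  below at an interior point has \<open>\<phi>\<^sub>t \<in> [0,\<mu>]\<close> there. Only the values \<open>U t x\<close> with
  \<open>0 \<le> x \<le> L\<close> are constrained.\<close>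

definition viscosity_solution ::
  "real \<Rightarrow> real \<Rightarrow> (real \<Rightarrow> real) \<Rightarrow> (real \<Rightarrow> real) \<Rightarrow> (real \<Rightarrow> real \<Rightarrow> real) \<Rightarrow> bool" where
  "viscosity_solution L \<mu> g u\<^sub>0 U \<longleftrightarrow>
     continuous_on (UNIV \<times> {0..L}) (\<lambda>(t, x). U t x) \<and>
     (\<forall>x\<in>{0..L}. mono (\<lambda>t. U t x) \<and> \<mu>-lipschitz_on UNIV (\<lambda>t. U t x)) \<and>
     viscosity_subsolution L g U \<and> viscosity_supersolution L g U \<and>
     (\<forall>t. U t 0 = u\<^sub>0 t)"

end

theory Submission
  imports Defs
begin

text \<open>For the affine Hamiltonian \<open>g u = u / V\<close> the equation is a transport equation, so a solution
  must be constant along the characteristics \<open>t - x / V = const\<close>, that is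
  \<open>U(t, x) = u\<^sub>0(t - x / V)\<close>. If a solution increased along a characteristic, then penalising the
  distance to that characteristic would produce a test function touching it from above whose
  derivative in the characteristic direction is positive; the subsolution property excludes this,
  and the supersolution property excludes a decrease in the same way. The two infima both reduce to
  \<open>released \<mu> Q (t - x / V)\<close>, because \<open>x g\<^sup>*((t - \<tau>) / x) = \<mu> max(0, t - x / V - \<tau>)\<close> and \<open>Q\<close> is
  non-decreasing.\<close>

section \<open>Legendre transform of the linear Hamiltonian\<close>

text \<open>The objective equals \<open>p * (q - 1 / V)\<close>, linear in \<open>p\<close>, so its
  maximum over \<open>{0..\<mu>}\<close> sits at an endpoint: \<open>0\<close> if the factor is
  nonpositive, \<open>\<mu>\<close> otherwise.\<close>

lemma legendre_linear:
  fixes V \<mu> :: real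
  assumes "\<mu> \<ge> 0" and g: "\<And>u. u \<in> {0..\<mu>} \<Longrightarrow> g u = u / V"
  shows "legendre {0..\<mu>} g q = \<mu> * max 0 (q - 1 / V)"
  unfolding legendre_def
proof (rule cSup_eq_maximum)
  have "\<mu> * max 0 (q - 1 / V) = q * (if q \<le> 1 / V then 0 else \<mu>) - g (if q \<le> 1 / V then 0 else \<mu>)"
    using assms(1) by (auto simp: g max_def algebra_simps)
  then show "\<mu> * max 0 (q - 1 / V) \<in> (\<lambda>p. q * p - g p) ` {0..\<mu>}"
    by (rule image_eqI) (use assms(1) in auto)
next
  fix y assume "y \<in> (\<lambda>p. q * p - g p) ` {0..\<mu>}"
  then obtain p where p: "p \<in> {0..\<mu>}" and "y = q * p - g p" by blast
  then have "y = p * (q - 1 / V)" by (simp only: g[OF p]) (simp add: right_diff_distrib mult.commute)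
  also have "\<dots> \<le> p * max 0 (q - 1 / V)" using p by (intro mult_left_mono) auto
  also have "\<dots> \<le> \<mu> * max 0 (q - 1 / V)" using p by (intro mult_right_mono) auto
  finally show "y \<le> \<mu> * max 0 (q - 1 / V)" .
qed

lemma scaled_legendre_linear:
  fixes V \<mu> x :: real
  assumes "\<mu> \<ge> 0" "x > 0" "\<And>u. u \<in> {0..\<mu>} \<Longrightarrow> g u = u / V"
  shows "x * legendre {0..\<mu>} g (r / x) = \<mu> * max 0 (r - x / V)"
proof -
  have "x * max 0 (r / x - 1 / V) = max (x * 0) (x * (r / x - 1 / V))"
    using assms(2) by (simp add: max_mult_distrib_left)
  also have "\<dots> = max 0 (r - x / V)"
    using assms(2) by (simp add: right_diff_distrib)
  finally have "\<mu> * (x * max 0 (r / x - 1 / V)) = \<mu> * max 0 (r - x / V)" by simp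
  moreover have "legendre {0..\<mu>} g (r / x) = \<mu> * max 0 (r / x - 1 / V)"
    by (rule legendre_linear[OF assms(1,3)])
  ultimately show ?thesis by (simp only: mult.left_commute)
qed

section \<open>The release function of the queue and its inf-convolutions\<close>

context
  fixes \<mu> :: real and Q :: "real \<Rightarrow> real"
  assumes mu_nonneg: "\<mu> \<ge> 0" and Q_nonneg: "\<And>t. Q t \<ge> 0" and Q_mono: "mono Q"
begin

lemma released_le: "\<tau> \<le> t \<Longrightarrow> released \<mu> Q t \<le> Q \<tau> + \<mu> * (t - \<tau>)"
  unfolding released_def
  \<comment> \<open>The bound \<open>0\<close> makes the infimum over reals a genuine one;
    \<open>cINF_lower\<close> requires it.\<close>
  by (rule cINF_lower) (auto intro!: bdd_belowI2[where m = 0] add_nonneg_nonneg mult_nonneg_nonneg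
      simp: mu_nonneg Q_nonneg)

lemma le_released: "(\<And>\<tau>. \<tau> \<le> t \<Longrightarrow> c \<le> Q \<tau> + \<mu> * (t - \<tau>)) \<Longrightarrow> c \<le> released \<mu> Q t"
  unfolding released_def by (rule cINF_greatest) auto

text \<open>A candidate \<open>\<tau> \<le> s\<close> costs no less at \<open>t\<close> than at
  \<open>s\<close>, and a candidate \<open>\<tau> > s\<close> costs at least \<open>Q s\<close>,
  which the choice \<open>\<tau> = s\<close> already achieves at time \<open>s\<close>.\<close>

lemma released_mono: "mono (released \<mu> Q)"
proof
  fix s t :: real assume st: "s \<le> t"
  show "released \<mu> Q s \<le> released \<mu> Q t"
  proof (rule le_released)
    fix \<tau> assume \<tau>: "\<tau> \<le> t"
    show "released \<mu> Q s \<le> Q \<tau> + \<mu> * (t - \<tau>)"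
    proof (cases "\<tau> \<le> s")
      case True
      have "\<mu> * (s - \<tau>) \<le> \<mu> * (t - \<tau>)" using st mu_nonneg by (intro mult_left_mono) auto
      then show ?thesis using released_le[OF True] by linarith
    next
      case False
      have "Q s \<le> Q \<tau>" using False by (intro monoD[OF Q_mono]) auto
      moreover have "0 \<le> \<mu> * (t - \<tau>)" using \<tau> mu_nonneg by simp
      ultimately show ?thesis using released_le[of s s] by simp
    qed
  qed
qed

lemma released_increment:
  assumes "s \<le> t"
  shows "released \<mu> Q t \<le> released \<mu> Q s + \<mu> * (t - s)"
proof -
  have "released \<mu> Q t - \<mu> * (t - s) \<le> released \<mu> Q s"
  proof (rule le_released)
    fix \<tau> assume "\<tau> \<le> s"
    then show "released \<mu> Q t - \<mu> * (t - s) \<le> Q \<tau> + \<mu> * (s - \<tau>)"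
      using released_le[of \<tau> t] assms by (simp add: algebra_simps)
  qed
  then show ?thesis by simp
qed

lemma released_lipschitz: "\<mu>-lipschitz_on UNIV (released \<mu> Q)"
proof (rule lipschitz_onI)
  fix s t :: real
  show "dist (released \<mu> Q s) (released \<mu> Q t) \<le> \<mu> * dist s t"
    using released_increment[of s t] released_increment[of t s]
      monoD[OF released_mono, of s t] monoD[OF released_mono, of t s]
    by (cases "s \<le> t") (auto simp: dist_real_def abs_if)
qed (rule mu_nonneg)

text \<open>The minimum is attained at \<open>\<tau> = s\<close>: earlier \<open>\<tau>\<close> are
  controlled by the growth rate \<open>\<mu>\<close>, later ones by monotonicity.\<close>

lemma inf_convolution_released: "(INF \<tau>. \<mu> * max 0 (s - \<tau>) + released \<mu> Q \<tau>) = released \<mu> Q s"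
proof (rule cInf_eq_minimum)
  show "released \<mu> Q s \<in> range (\<lambda>\<tau>. \<mu> * max 0 (s - \<tau>) + released \<mu> Q \<tau>)"
    by (rule image_eqI[where x = s]) auto
next
  fix y assume "y \<in> range (\<lambda>\<tau>. \<mu> * max 0 (s - \<tau>) + released \<mu> Q \<tau>)"
  then obtain \<tau> where "y = \<mu> * max 0 (s - \<tau>) + released \<mu> Q \<tau>" by auto
  then show "released \<mu> Q s \<le> y"
    using released_increment[of \<tau> s] monoD[OF released_mono, of s \<tau>]
    by (cases "\<tau> \<le> s") (auto simp: max_def)
qed

text \<open>The terms with \<open>\<tau> \<le> s\<close> are those defining \<open>released\<close>;
  a term with \<open>\<tau> > s\<close> is at least \<open>Q s\<close>, so admitting it does not
  lower the infimum.\<close>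

lemma inf_convolution_arrivals: "(INF \<tau>. \<mu> * max 0 (s - \<tau>) + Q \<tau>) = released \<mu> Q s"
proof (rule antisym)
  have bdd: "bdd_below (range (\<lambda>\<tau>. \<mu> * max 0 (s - \<tau>) + Q \<tau>))"
    by (auto intro!: bdd_belowI2[where m = 0] add_nonneg_nonneg mult_nonneg_nonneg
      simp: mu_nonneg Q_nonneg)
  show "(INF \<tau>. \<mu> * max 0 (s - \<tau>) + Q \<tau>) \<le> released \<mu> Q s"
  proof (rule le_released)
    fix \<tau> assume "\<tau> \<le> s"
    then show "(INF \<tau>. \<mu> * max 0 (s - \<tau>) + Q \<tau>) \<le> Q \<tau> + \<mu> * (s - \<tau>)"
      using cINF_lower[OF bdd, of \<tau>] by (simp add: max_def)
  qed
  show "released \<mu> Q s \<le> (INF \<tau>. \<mu> * max 0 (s - \<tau>) + Q \<tau>)"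
  proof (rule cINF_greatest)
    fix \<tau>
    show "released \<mu> Q s \<le> \<mu> * max 0 (s - \<tau>) + Q \<tau>"
      using released_le[of \<tau> s] released_le[of s s] monoD[OF Q_mono, of s \<tau>]
      by (cases "\<tau> \<le> s") (auto simp: max_def)
  qed simp
qed

end

section \<open>Test functions: slopes at touching points and restriction to lines\<close>

text \<open>Touching gives \<open>p t - p t0 \<ge> f t - f t0\<close> near \<open>t0\<close>. Points
  to the right yield \<open>D \<ge> 0\<close> by monotonicity, points to the left yield
  \<open>D \<le> \<mu>\<close> by the Lipschitz bound. This places the slope where the formula for
  \<open>g\<close> is available.\<close>

lemma touching_slope_above:
  fixes f p :: "real \<Rightarrow> real"
  assumes "mono f" "\<mu>-lipschitz_on UNIV f" and p: "(p has_real_derivative D) (at t0)"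
    and touch: "\<forall>\<^sub>F t in nhds t0. f t - p t \<le> f t0 - p t0"
  shows "D \<in> {0..\<mu>}"
proof -
  obtain e where e: "e > 0" "\<And>t. dist t t0 < e \<Longrightarrow> f t - p t \<le> f t0 - p t0"
    using touch by (auto simp: eventually_nhds_metric)
  have "D \<ge> 0"
  proof (rule ccontr)
    assume "\<not> D \<ge> 0"
    then obtain d where d: "d > 0" "\<And>h. 0 < h \<Longrightarrow> h < d \<Longrightarrow> p t0 > p (t0 + h)"
      using DERIV_neg_dec_right[OF p] by auto
    define h where "h = min d e / 2"
    have h: "0 < h" "h < d" "h < e" using e(1) d(1) by (auto simp: h_def)
    have "f t0 \<le> f (t0 + h)" using h by (intro monoD[OF assms(1)]) auto
    then show False using d(2)[OF h(1,2)] e(2)[of "t0 + h"] h by (auto simp: dist_real_def)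
  qed
  moreover have "D \<le> \<mu>"
  proof (rule ccontr)
    assume "\<not> D \<le> \<mu>"
    moreover have "((\<lambda>t. p t - \<mu> * t) has_real_derivative D - \<mu>) (at t0)"
      by (auto intro!: derivative_eq_intros p)
    ultimately obtain d where d: "d > 0"
      "\<And>h. 0 < h \<Longrightarrow> h < d \<Longrightarrow> p (t0 - h) - \<mu> * (t0 - h) < p t0 - \<mu> * t0"
      using DERIV_pos_inc_left[of "\<lambda>t. p t - \<mu> * t" "D - \<mu>" t0] by auto
    define h where "h = min d e / 2"
    have h: "0 < h" "h < d" "h < e" using e(1) d(1) by (auto simp: h_def)
    have "\<bar>f t0 - f (t0 - h)\<bar> \<le> \<mu> * h"
      using lipschitz_onD[OF assms(2), of t0 "t0 - h"] h by (simp add: dist_real_def)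
    then show False using d(2)[OF h(1,2)] e(2)[of "t0 - h"] h
      by (auto simp: dist_real_def algebra_simps)
  qed
  ultimately show ?thesis by simp
qed

text \<open>The point reflection \<open>f \<mapsto> (\<lambda>t. - f (- t))\<close> keeps
  monotonicity, the Lipschitz constant and the slope \<open>D\<close>, but exchanges touching from
  below with touching from above.\<close>

lemma touching_slope_below:
  fixes f p :: "real \<Rightarrow> real"
  assumes "mono f" "\<mu>-lipschitz_on UNIV f" and p: "(p has_real_derivative D) (at t0)"
    and touch: "\<forall>\<^sub>F t in nhds t0. f t - p t \<ge> f t0 - p t0"
  shows "D \<in> {0..\<mu>}"
proof (rule touching_slope_above[where f = "\<lambda>t. - f (- t)" and p = "\<lambda>t. - p (- t)" and ?t0.0 = "- t0"])
  show "mono (\<lambda>t. - f (- t))"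
    using assms(1) by (auto simp: mono_def)
  show "\<mu>-lipschitz_on UNIV (\<lambda>t. - f (- t))"
  proof (rule lipschitz_onI)
    fix s t :: real
    show "dist (- f (- s)) (- f (- t)) \<le> \<mu> * dist s t"
      using lipschitz_onD[OF assms(2), of "- s" "- t"] by (simp add: dist_minus)
  qed (rule lipschitz_on_nonneg[OF assms(2)])
  have "((\<lambda>t. p (- t)) has_real_derivative D * (- 1)) (at (- t0))"
    by (rule DERIV_chain2[where f = p]) (auto intro!: derivative_eq_intros p)
  then show "((\<lambda>t. - p (- t)) has_real_derivative D) (at (- t0))"
    by (auto dest: DERIV_minus)
  have "filterlim uminus (nhds t0) (nhds (- t0))"
    by (auto intro!: tendsto_eq_intros filterlim_ident)
  from filterlim_iff[THEN iffD1, OF this, rule_format, OF touch]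
  show "\<forall>\<^sub>F t in nhds (- t0). - f (- t) - - p (- t) \<le> - f (- (- t0)) - - p (- (- t0))"
    by eventually_elim simp
qed

lemma C1_test_section:
  assumes "C1_test \<phi> \<phi>t \<phi>x"
  shows "((\<lambda>t. \<phi> (t, x0)) has_real_derivative \<phi>t (t0, x0)) (at t0)"
proof -
  have d: "(\<phi> has_derivative (\<lambda>h. \<phi>t (t0, x0) * fst h + \<phi>x (t0, x0) * snd h)) (at (t0, x0))"
    using assms by (auto simp: C1_test_def)
  have "((\<lambda>t. \<phi> (t, x0)) has_derivative
      (\<lambda>h. \<phi>t (t0, x0) * fst (h, 0::real) + \<phi>x (t0, x0) * snd (h, 0::real))) (at t0)"
    by (rule has_derivative_compose[where f = "\<lambda>t. (t, x0)" and f' = "\<lambda>h. (h, 0)" and x = t0, OF _ d]) (auto intro!: derivative_eq_intros)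
  then show ?thesis
    by (simp add: has_field_derivative_def)
qed

text \<open>For \<open>g u = a * u\<close> the left side of the equation is exactly this derivative
  in the direction \<open>(a, 1)\<close>.\<close>

lemma C1_test_characteristic:
  assumes "C1_test \<phi> \<phi>t \<phi>x"
  shows "((\<lambda>h. \<phi> (t0 + a * h, x0 + h)) has_real_derivative a * \<phi>t (t0, x0) + \<phi>x (t0, x0)) (at 0)"
proof -
  \<comment> \<open>The base point is written as the value of the line at \<open>0\<close>, to match
    the chain rule.\<close>
  have d: "(\<phi> has_derivative (\<lambda>h. \<phi>t (t0, x0) * fst h + \<phi>x (t0, x0) * snd h))
      (at (t0 + a * 0, x0 + 0))"
    using assms by (auto simp: C1_test_def)
  have "((\<lambda>h. \<phi> (t0 + a * h, x0 + h)) has_derivative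
      (\<lambda>h. \<phi>t (t0, x0) * fst (a * h, h) + \<phi>x (t0, x0) * snd (a * h, h))) (at 0)"
    by (rule has_derivative_compose[where f = "\<lambda>h. (t0 + a * h, x0 + h)" and x = 0, OF _ d]) (auto intro!: derivative_eq_intros)
  moreover have "(\<lambda>h. \<phi>t (t0, x0) * fst (a * h, h) + \<phi>x (t0, x0) * snd (a * h, h))
      = (*) (a * \<phi>t (t0, x0) + \<phi>x (t0, x0))"
    by (auto simp: algebra_simps)
  ultimately show ?thesis
    by (simp add: has_field_derivative_def)
qed

lemma eventually_nhds_section:
  assumes "\<forall>\<^sub>F (t, x) in nhds (t0, x0). P t x"
  shows "\<forall>\<^sub>F t in nhds t0. P t x0"
proof -
  have "filterlim (\<lambda>t. (t, x0)) (nhds (t0, x0)) (nhds t0)"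
    by (auto intro!: tendsto_eq_intros filterlim_ident)
  from filterlim_iff[THEN iffD1, OF this, rule_format, OF assms] show ?thesis by simp
qed

lemma eventually_nhds_characteristic:
  fixes t0 x0 a :: real
  assumes "\<forall>\<^sub>F (t, x) in nhds (t0, x0). P t x"
  shows "\<forall>\<^sub>F h in nhds 0. P (t0 + a * h) (x0 + h)"
proof -
  have "filterlim (\<lambda>h. (t0 + a * h, x0 + h)) (nhds (t0, x0)) (nhds 0)"
    by (auto intro!: tendsto_eq_intros filterlim_ident)
  from filterlim_iff[THEN iffD1, OF this, rule_format, OF assms] show ?thesis by simp
qed

section \<open>Existence: the transported initial datum is a solution\<close>

text \<open>The candidate is constant along characteristics, so a test function touching it has a
  local extremum there and \<open>a * \<phi>t + \<phi>x\<close> vanishes. Both viscosity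
  inequalities thus hold with equality.\<close>

lemma transport_viscosity_solution:
  fixes u0 :: "real \<Rightarrow> real"
  assumes u0: "mono u0" "\<mu>-lipschitz_on UNIV u0"
    and g: "\<And>u. u \<in> {0..\<mu>} \<Longrightarrow> g u = a * u"
  shows "viscosity_solution L \<mu> g u0 (\<lambda>t x. u0 (t - a * x))"
proof -
  have mono: "mono (\<lambda>t. u0 (t - a * x))" for x
    using u0(1) by (auto simp: mono_def)
  have lip: "\<mu>-lipschitz_on UNIV (\<lambda>t. u0 (t - a * x))" for x
  proof (rule lipschitz_onI)
    fix s t :: real
    show "dist (u0 (s - a * x)) (u0 (t - a * x)) \<le> \<mu> * dist s t"
      using lipschitz_onD[OF u0(2), of "s - a * x" "t - a * x"] by (simp add: dist_real_def)
  qed (rule lipschitz_on_nonneg[OF u0(2)])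
  have cont: "continuous_on UNIV u0"
    by (rule lipschitz_on_continuous_on[OF u0(2)])
  have cont': "continuous_on (UNIV \<times> {0..L}) (\<lambda>(t, x). u0 (t - a * x))"
    unfolding split_beta
    by (rule continuous_on_compose2[OF cont]) (auto intro!: continuous_intros)
  have along: "t0 + a * h - a * (x0 + h) = t0 - a * x0" for t0 h x0
    by (simp add: algebra_simps)
  have "viscosity_subsolution L g (\<lambda>t x. u0 (t - a * x))"
    unfolding viscosity_subsolution_def
  proof (intro allI impI, elim conjE)
    fix \<phi> \<phi>t \<phi>x t0 x0
    assume C1: "C1_test \<phi> \<phi>t \<phi>x" and
      touch: "\<forall>\<^sub>F (t, x) in nhds (t0, x0). u0 (t - a * x) - \<phi> (t, x) \<le> u0 (t0 - a * x0) - \<phi> (t0, x0)"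
    have "\<phi>t (t0, x0) \<in> {0..\<mu>}"
      by (rule touching_slope_above[OF mono lip C1_test_section[OF C1] eventually_nhds_section[OF touch]])
    moreover have "\<forall>\<^sub>F h in nhds 0. \<phi> (t0 + a * 0, x0 + 0) \<le> \<phi> (t0 + a * h, x0 + h)"
      using eventually_nhds_characteristic[OF touch, of a] by eventually_elim (simp add: along)
    then have "a * \<phi>t (t0, x0) + \<phi>x (t0, x0) = 0"
      using DERIV_local_min[OF C1_test_characteristic[OF C1, of t0 a x0]]
      by (auto simp: eventually_nhds_metric dist_real_def)
    ultimately show "\<phi>x (t0, x0) + g (\<phi>t (t0, x0)) \<le> 0" by (simp add: g)
  qed
  moreover have "viscosity_supersolution L g (\<lambda>t x. u0 (t - a * x))"
    unfolding viscosity_supersolution_def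
  proof (intro allI impI, elim conjE)
    fix \<phi> \<phi>t \<phi>x t0 x0
    assume C1: "C1_test \<phi> \<phi>t \<phi>x" and
      touch: "\<forall>\<^sub>F (t, x) in nhds (t0, x0). u0 (t - a * x) - \<phi> (t, x) \<ge> u0 (t0 - a * x0) - \<phi> (t0, x0)"
    have "\<phi>t (t0, x0) \<in> {0..\<mu>}"
      by (rule touching_slope_below[OF mono lip C1_test_section[OF C1] eventually_nhds_section[OF touch]])
    moreover have "\<forall>\<^sub>F h in nhds 0. \<phi> (t0 + a * 0, x0 + 0) \<ge> \<phi> (t0 + a * h, x0 + h)"
      using eventually_nhds_characteristic[OF touch, of a] by eventually_elim (simp add: along)
    then have "a * \<phi>t (t0, x0) + \<phi>x (t0, x0) = 0"
      using DERIV_local_max[OF C1_test_characteristic[OF C1, of t0 a x0]]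
      by (auto simp: eventually_nhds_metric dist_real_def)
    ultimately show "\<phi>x (t0, x0) + g (\<phi>t (t0, x0)) \<ge> 0" by (simp add: g)
  qed
  ultimately show ?thesis
    using cont' mono lip by (simp add: viscosity_solution_def)
qed

section \<open>Uniqueness: solutions are constant along characteristics\<close>

text \<open>In the coordinate \<open>s = t - a * x\<close>, maximise \<open>u\<close> minus an
  increasing function of \<open>x\<close> and a quadratic in \<open>s - s0\<close>. The quadratic
  does not vary along characteristics, so at an interior maximum only the increasing part
  contributes to \<open>\<phi>x + a * \<phi>t\<close>. The hypotheses on continuity and Lipschitz
  bound are stable under negating \<open>u\<close>, so the lemma also serves falling
  solutions.\<close>

lemma rising_along_characteristic_touched:
  fixes u :: "real \<Rightarrow> real \<Rightarrow> real"
  assumes cont: "continuous_on (UNIV \<times> {0..L}) (\<lambda>(t, x). u t x)"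
    and lip: "\<And>x. x \<in> {0..L} \<Longrightarrow> \<mu>-lipschitz_on UNIV (\<lambda>t. u t x)"
    and x1: "0 < x1" "x1 < L" and rise: "u s0 0 < u (s0 + a * x1) x1"
  obtains \<phi> \<phi>t \<phi>x t0 x0 where "C1_test \<phi> \<phi>t \<phi>x" "0 < x0" "x0 < L"
    "\<forall>\<^sub>F (t, x) in nhds (t0, x0). u t x - \<phi> (t, x) \<le> u t0 x0 - \<phi> (t0, x0)"
    "\<phi>x (t0, x0) + a * \<phi>t (t0, x0) > 0"
proof -
  define f where "f x = u (s0 + a * x) x" for x
  define c where "c = (f x1 - f 0) / 2"
  \<comment> \<open>The box ends strictly between \<open>x1\<close> and \<open>L\<close>, leaving
    room for the penalty \<open>\<psi>\<close> to grow beyond \<open>x1\<close>.\<close>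
  define x2 where "x2 = (x1 + L) / 2"
  have x2: "x1 < x2" "x2 < L" using x1 by (auto simp: x2_def)
  have c: "c > 0" using rise by (simp add: c_def f_def)
  txt \<open>The rate \<open>K\<close> makes \<open>\<psi>\<close> so large at \<open>x2\<close> that the penalised maximum cannot be attained
    there, while \<open>\<psi> x1 = c\<close> stays below the rise \<open>2 c\<close>; the weight \<open>N\<close> keeps the
    maximum off the lateral boundary and makes the Lipschitz variation in \<open>t\<close> cost less than \<open>c\<close>.\<close>
  define K where "K = \<bar>f x2 - f 0\<bar> / (c * (x2 - x1)) + 1"
  have K: "K > 0" using c x2 by (auto simp: K_def intro!: add_nonneg_pos)
  define \<psi> where "\<psi> x = c * exp (K * (x - x1))" for x
  have \<psi>_pos: "\<psi> x > 0" for x using c by (simp add: \<psi>_def)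
  have \<mu>: "\<mu> \<ge> 0" using lip[of 0] x1 by (auto dest: lipschitz_on_nonneg)
  have cont': "continuous_on (UNIV \<times> {0..x2}) (\<lambda>z. u (fst z + a * snd z) (snd z))"
  proof -
    have "continuous_on (UNIV \<times> {0..x2})
        (\<lambda>z. (\<lambda>(t, x). u t x) ((\<lambda>z. (fst z + a * snd z, snd z)) z))"
      by (rule continuous_on_compose2[OF cont]) (use x2 in \<open>auto intro!: continuous_intros\<close>)
    then show ?thesis by simp
  qed
  have "continuous_on {0..x2} f"
  proof -
    have "continuous_on {0..x2} (\<lambda>x. (\<lambda>z. u (fst z + a * snd z) (snd z)) (s0, x))"
      by (rule continuous_on_compose2[OF cont']) (auto intro!: continuous_intros)
    then show ?thesis by (simp add: f_def)
  qed
  then have "bdd_above (f ` {0..x2})"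
    by (intro bounded_imp_bdd_above compact_imp_bounded compact_continuous_image) auto
  then obtain B where B: "\<And>x. x \<in> {0..x2} \<Longrightarrow> f x \<le> B"
    unfolding bdd_above_def by blast
  define N where "N = \<mu>\<^sup>2 / c + \<bar>B + \<mu> - f 0\<bar> + 1"
  have N: "N > 0" "N \<ge> \<mu>\<^sup>2 / c + 1" "N > B + \<mu> - f 0"
  proof -
    have "\<mu>\<^sup>2 / c \<ge> 0" using c by simp
    then show "N > 0" "N \<ge> \<mu>\<^sup>2 / c + 1" "N > B + \<mu> - f 0"
      by (simp_all add: N_def add_nonneg_pos abs_if)
  qed
  \<comment> \<open>The first component of \<open>z\<close> is \<open>s\<close>, not
    \<open>t\<close>; characteristics become the lines of constant \<open>s\<close>. With half-width
    1 below, the quadratic equals \<open>N\<close> on the lateral sides.\<close>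
  define F where "F z = u (fst z + a * snd z) (snd z) - \<psi> (snd z) - N * (fst z - s0)\<^sup>2" for z
  define box where "box = {s0 - 1..s0 + 1} \<times> {0..x2}"
  have "compact box" unfolding box_def by (intro compact_Times) auto
  moreover have "(s0, x1) \<in> box" using x1 x2 by (auto simp: box_def)
  moreover have "continuous_on box F"
    unfolding F_def \<psi>_def
    by (intro continuous_intros continuous_on_subset[OF cont']) (auto simp: box_def)
  ultimately obtain z where z: "z \<in> box" and zmax: "\<And>y. y \<in> box \<Longrightarrow> F y \<le> F z"
    using continuous_attains_sup[of box F] by blast
  define s where "s = fst z" define x0 where "x0 = snd z"
  have s: "s0 - 1 \<le> s" "s \<le> s0 + 1" and x0: "0 \<le> x0" "x0 \<le> x2"
    using z by (auto simp: box_def s_def x0_def)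
  \<comment> \<open>The value of \<open>F\<close> at \<open>(s0, x1)\<close>: the rise
    \<open>2 * c\<close> minus \<open>\<psi> x1 = c\<close>.\<close>
  have low: "f 0 + c \<le> F z"
    using zmax[OF \<open>(s0, x1) \<in> box\<close>] by (simp add: F_def \<psi>_def f_def c_def field_simps)
  have "u (s + a * x0) x0 \<le> f x0 + \<mu> * \<bar>s - s0\<bar>"
    using lipschitz_onD[OF lip[of x0], of "s + a * x0" "s0 + a * x0"] x0 x2
    by (simp add: f_def dist_real_def)
  then have up: "F z \<le> f x0 - \<psi> x0 + (\<mu> * \<bar>s - s0\<bar> - N * (s - s0)\<^sup>2)"
    by (simp add: F_def s_def x0_def)
  \<comment> \<open>Completing the square reduces this to \<open>\<mu>^2 < 4 * N * c\<close>, which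
    the choice of \<open>N\<close> ensures.\<close>
  have "\<mu> * r - N * r\<^sup>2 < c" for r
  proof -
    have "N * c \<ge> \<mu>\<^sup>2 + c" using mult_right_mono[OF N(2), of c] c by (simp add: distrib_right)
    then have "N * c - \<mu>\<^sup>2 / 4 > 0" using c zero_le_power2[of \<mu>] by linarith
    then have "0 < (N * r - \<mu> / 2)\<^sup>2 + (N * c - \<mu>\<^sup>2 / 4)" by (intro add_nonneg_pos) auto
    also have "\<dots> = N * (c - (\<mu> * r - N * r\<^sup>2))" by (simp add: power2_eq_square field_simps)
    finally show ?thesis using N(1) by (simp add: zero_less_mult_iff)
  qed
  from this[of "\<bar>s - s0\<bar>"] have pen: "\<mu> * \<bar>s - s0\<bar> - N * (s - s0)\<^sup>2 < c" by simp
  \<comment> \<open>At \<open>x0 = 0\<close> the bounds would give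
    \<open>F z < f 0 + c - \<psi> 0\<close>, below the level in \<open>low\<close>.\<close>
  have "x0 \<noteq> 0"
    using up pen low \<psi>_pos[of x0] by auto
  moreover have "x0 \<noteq> x2"
  proof
    assume eq: "x0 = x2"
    have "K * (c * (x2 - x1)) = \<bar>f x2 - f 0\<bar> + c * (x2 - x1)"
      using c x2 by (simp add: K_def distrib_right)
    moreover have "c * (x2 - x1) > 0" using c x2 by simp
    ultimately have "f x2 - f 0 \<le> K * (c * (x2 - x1))" by linarith
    also have "\<dots> = c * (K * (x2 - x1))" by simp
    \<comment> \<open>From \<open>exp y \<ge> 1 + y\<close>: the penalty at \<open>x2\<close>
      absorbs all of \<open>f x2 - f 0\<close>.\<close>
    also have "\<dots> \<le> \<psi> x2"
      unfolding \<psi>_def using c by (intro mult_left_mono order.trans[OF _ exp_ge_add_one_self]) auto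
    finally show False using up pen low eq by simp
  qed
  ultimately have x0': "0 < x0" "x0 < x2" using x0 by auto
  have "\<bar>s - s0\<bar> \<noteq> 1"
  proof
    assume eq: "\<bar>s - s0\<bar> = 1"
    then have "(s - s0)\<^sup>2 = 1" by (metis power2_abs one_power2)
    \<comment> \<open>Here \<open>F z\<close> is at most \<open>B + \<mu> - N\<close>, which is less
      than \<open>f 0\<close>.\<close>
    then show False using up low eq N(3) B[of x0] \<psi>_pos[of x0] c x0 by simp
  qed
  then have s': "s0 - 1 < s" "s < s0 + 1" using s by auto
  \<comment> \<open>The same penalty in the original coordinates;
    \<open>\<phi>x + a * \<phi>t\<close> collapses to \<open>K * \<psi>\<close>, which is
    positive.\<close>
  define \<phi> where "\<phi> y = \<psi> (snd y) + N * (fst y - a * snd y - s0)\<^sup>2" for y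
  define \<phi>t where "\<phi>t y = 2 * N * (fst y - a * snd y - s0)" for y :: "real \<times> real"
  define \<phi>x where "\<phi>x y = K * \<psi> (snd y) - a * \<phi>t y" for y
  have "C1_test \<phi> \<phi>t \<phi>x"
    unfolding C1_test_def
  proof (intro conjI allI)
    show "continuous_on UNIV \<phi>t" "continuous_on UNIV \<phi>x"
      unfolding \<phi>x_def \<phi>t_def \<psi>_def by (intro continuous_intros)+
    show "(\<phi> has_derivative (\<lambda>h. \<phi>t y * fst h + \<phi>x y * snd h)) (at y)" for y
      unfolding \<phi>_def \<psi>_def \<phi>t_def \<phi>x_def
      by (auto intro!: derivative_eq_intros simp: fun_eq_iff algebra_simps power2_eq_square)
  qed
  moreover have "\<forall>\<^sub>F (t, x) in nhds (s + a * x0, x0).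
      u t x - \<phi> (t, x) \<le> u (s + a * x0) x0 - \<phi> (s + a * x0, x0)"
  proof -
    \<comment> \<open>The preimage of the open box under the straightening map is a neighbourhood on
      which the maximality of \<open>z\<close> applies.\<close>
    define S where "S = (\<lambda>y. (fst y - a * snd y, snd y)) -` ({s0 - 1<..<s0 + 1} \<times> {0<..<x2})"
    have "open S" unfolding S_def
      by (intro open_vimage open_Times continuous_intros)
    moreover have "(s + a * x0, x0) \<in> S" using s' x0' by (auto simp: S_def)
    ultimately have "\<forall>\<^sub>F y in nhds (s + a * x0, x0). y \<in> S" by (rule eventually_nhds_in_open)
    then show ?thesis
    proof (eventually_elim, clarify)
      fix t x assume "(t, x) \<in> S"
      then have "(t - a * x, x) \<in> box" by (auto simp: S_def box_def)
      from zmax[OF this] show "u t x - \<phi> (t, x) \<le> u (s + a * x0) x0 - \<phi> (s + a * x0, x0)"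
        by (simp add: F_def \<phi>_def s_def x0_def)
    qed
  qed
  moreover have "\<phi>x (s + a * x0, x0) + a * \<phi>t (s + a * x0, x0) > 0"
    using K \<psi>_pos by (simp add: \<phi>x_def)
  ultimately show thesis using that x0' x2 by (meson order.strict_trans)
qed

text \<open>A rise contradicts the subsolution property and a rise of \<open>- U\<close> the
  supersolution property, once the slope bound allows \<open>g (\<phi>t)\<close> to be replaced by
  \<open>a * \<phi>t\<close>.\<close>

lemma viscosity_solution_constant_interior:
  assumes sol: "viscosity_solution L \<mu> g u0 U"
    and g: "\<And>u. u \<in> {0..\<mu>} \<Longrightarrow> g u = a * u" and x: "0 < x" "x < L"
  shows "U (s + a * x) x = U s 0"
proof (rule antisym)
  have cont: "continuous_on (UNIV \<times> {0..L}) (\<lambda>(t, x). U t x)"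
    and mono: "\<And>x. x \<in> {0..L} \<Longrightarrow> mono (\<lambda>t. U t x)"
    and lip: "\<And>x. x \<in> {0..L} \<Longrightarrow> \<mu>-lipschitz_on UNIV (\<lambda>t. U t x)"
    and sub: "viscosity_subsolution L g U" and super: "viscosity_supersolution L g U"
    using sol by (auto simp: viscosity_solution_def)
  show "U (s + a * x) x \<le> U s 0"
  proof (rule ccontr)
    assume "\<not> U (s + a * x) x \<le> U s 0"
    then have rise: "U s 0 < U (s + a * x) x" by simp
    obtain \<phi> \<phi>t \<phi>x t0 x0 where C1: "C1_test \<phi> \<phi>t \<phi>x" and x0: "0 < x0" "x0 < L"
      and touch: "\<forall>\<^sub>F (t, x) in nhds (t0, x0). U t x - \<phi> (t, x) \<le> U t0 x0 - \<phi> (t0, x0)"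
      and pos: "\<phi>x (t0, x0) + a * \<phi>t (t0, x0) > 0"
      by (rule rising_along_characteristic_touched[where u = U, OF cont lip x rise])
    have "\<phi>x (t0, x0) + g (\<phi>t (t0, x0)) \<le> 0"
      using sub C1 x0 touch unfolding viscosity_subsolution_def by blast
    moreover have "\<phi>t (t0, x0) \<in> {0..\<mu>}"
      by (rule touching_slope_above[OF mono lip C1_test_section[OF C1] eventually_nhds_section[OF touch]])
        (use x0 in auto)
    ultimately show False using pos by (simp add: g)
  qed
  show "U s 0 \<le> U (s + a * x) x"
  proof (rule ccontr)
    assume "\<not> U s 0 \<le> U (s + a * x) x"
    then have fall: "- U s 0 < - U (s + a * x) x" by simp
    have cont': "continuous_on (UNIV \<times> {0..L}) (\<lambda>(t, x). - U t x)"
      using continuous_on_minus[OF cont] by (simp add: split_beta)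
    have lip': "\<mu>-lipschitz_on UNIV (\<lambda>t. - U t x)" if "x \<in> {0..L}" for x
      using lip[OF that] by (simp add: lipschitz_on_def dist_minus)
    obtain \<phi> \<phi>t \<phi>x t0 x0 where C1: "C1_test \<phi> \<phi>t \<phi>x" and x0: "0 < x0" "x0 < L"
      and touch: "\<forall>\<^sub>F (t, x) in nhds (t0, x0). - U t x - \<phi> (t, x) \<le> - U t0 x0 - \<phi> (t0, x0)"
      and pos: "\<phi>x (t0, x0) + a * \<phi>t (t0, x0) > 0"
      by (rule rising_along_characteristic_touched[where u = "\<lambda>t x. - U t x", OF cont' lip' x fall])
    \<comment> \<open>\<open>- U\<close> is not non-decreasing, so the slope bound is obtained by
      returning to \<open>U\<close>, which \<open>- \<phi>\<close> touches from below.\<close>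
    have C1': "C1_test (\<lambda>y. - \<phi> y) (\<lambda>y. - \<phi>t y) (\<lambda>y. - \<phi>x y)"
      unfolding C1_test_def
    proof (intro conjI allI)
      show "continuous_on UNIV (\<lambda>y. - \<phi>t y)" "continuous_on UNIV (\<lambda>y. - \<phi>x y)"
        using C1 by (auto simp: C1_test_def intro: continuous_on_minus)
      show "((\<lambda>y. - \<phi> y) has_derivative (\<lambda>h. - \<phi>t y * fst h + - \<phi>x y * snd h)) (at y)" for y
      proof -
        have "(\<phi> has_derivative (\<lambda>h. \<phi>t y * fst h + \<phi>x y * snd h)) (at y)"
          using C1 unfolding C1_test_def by blast
        from has_derivative_minus[OF this] show ?thesis by simp
      qed
    qed
    have touch': "\<forall>\<^sub>F (t, x) in nhds (t0, x0). U t x - - \<phi> (t, x) \<ge> U t0 x0 - - \<phi> (t0, x0)"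
      using touch by eventually_elim auto
    have "- \<phi>x (t0, x0) + g (- \<phi>t (t0, x0)) \<ge> 0"
      using super[unfolded viscosity_supersolution_def, rule_format, of "\<lambda>y. - \<phi> y" "\<lambda>y. - \<phi>t y"
          "\<lambda>y. - \<phi>x y" x0 t0] C1' x0 touch' by simp
    moreover have "- \<phi>t (t0, x0) \<in> {0..\<mu>}"
      by (rule touching_slope_below[OF mono lip C1_test_section[OF C1'] eventually_nhds_section[OF touch']])
        (use x0 in auto)
    ultimately show False using pos by (simp add: g)
  qed
qed

text \<open>The viscosity inequalities act only at interior \<open>x\<close>; continuity along the
  characteristic carries constancy to the closed interval, including \<open>x = L\<close>.\<close>

lemma viscosity_solution_transport:
  assumes sol: "viscosity_solution L \<mu> g u0 U" and "L > 0"
    and g: "\<And>u. u \<in> {0..\<mu>} \<Longrightarrow> g u = a * u" and x: "x \<in> {0..L}"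
  shows "U t x = u0 (t - a * x)"
proof -
  define s where "s = t - a * x"
  have "continuous_on {0..L} (\<lambda>x. (\<lambda>(t, x). U t x) (s + a * x, x))"
    by (rule continuous_on_compose2[where t = "UNIV \<times> {0..L}"])
      (use sol in \<open>auto simp: viscosity_solution_def intro!: continuous_intros\<close>)
  then have "continuous_on {0..L} (\<lambda>x. U (s + a * x) x)" by simp
  then have "continuous_on (closure {0<..<L}) (\<lambda>x. U (s + a * x) x)"
    using \<open>L > 0\<close> by simp
  moreover have "x \<in> closure {0<..<L}" using x \<open>L > 0\<close> by simp
  moreover have "U (s + a * y) y = U s 0" if "y \<in> {0<..<L}" for y
    using viscosity_solution_constant_interior[OF sol g] that by auto
  ultimately have "U (s + a * x) x = U s 0"
    using continuous_constant_on_closure[of "{0<..<L}" "\<lambda>x. U (s + a * x) x" "U s 0" x] by blast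
  then show ?thesis using sol by (simp add: s_def viscosity_solution_def)
qed

theorem proposition3p2:
  fixes L V \<mu> :: real and Q g :: "real \<Rightarrow> real"
  assumes "L > 0" and "V > 0" and "\<mu> > 0"
    and "\<And>t. Q t \<ge> 0" and "mono Q" and "\<And>t. continuous (at_left t) Q"
    and "\<And>t. t < 0 \<Longrightarrow> Q t = 0"
    and "\<And>u. u \<in> {0..\<mu>} \<Longrightarrow> g u = u / V"
  shows "(\<exists>U. viscosity_solution L \<mu> g (released \<mu> Q) U \<and>
            (\<forall>U'. viscosity_solution L \<mu> g (released \<mu> Q) U' \<longrightarrow>
               (\<forall>t. \<forall>x\<in>{0..L}. U' t x = U t x))) \<and>
         (\<forall>U. viscosity_solution L \<mu> g (released \<mu> Q) U \<longrightarrow>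
            (\<forall>t>0. \<forall>x\<in>{0<..L}.
               U t x = (INF \<tau>. x * legendre {0..\<mu>} g ((t - \<tau>) / x) + released \<mu> Q \<tau>) \<and>
               U t x = (INF \<tau>. x * legendre {0..\<mu>} g ((t - \<tau>) / x) + Q \<tau>))) \<and>
         (\<forall>q. legendre {0..\<mu>} g q = (if q \<le> 1 / V then 0 else (q - 1 / V) * \<mu>))"
proof -
  let ?R = "released \<mu> Q"
  have \<mu>: "\<mu> \<ge> 0" using assms(3) by simp
  note Q = \<mu> assms(4,5)
  have g: "g u = 1 / V * u" if "u \<in> {0..\<mu>}" for u using assms(8)[OF that] by simp
  have sol: "viscosity_solution L \<mu> g ?R (\<lambda>t x. ?R (t - 1 / V * x))"
    by (rule transport_viscosity_solution[OF released_mono[OF Q] released_lipschitz[OF Q] g])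
  have unique: "U t x = ?R (t - 1 / V * x)"
    if "viscosity_solution L \<mu> g ?R U" "x \<in> {0..L}" for U t x
    by (rule viscosity_solution_transport[OF that(1) assms(1) g that(2)])
  \<comment> \<open>Both infima become inf-convolutions at the foot \<open>t - x / V\<close> of the
    characteristic through \<open>(t, x)\<close>.\<close>
  have cost: "x * legendre {0..\<mu>} g ((t - \<tau>) / x) = \<mu> * max 0 ((t - 1 / V * x) - \<tau>)"
    if "x > 0" for x t \<tau>
    using scaled_legendre_linear[where g = g, OF \<mu> that assms(8), of "t - \<tau>"]
    by (simp add: algebra_simps)
  have "U t x = (INF \<tau>. x * legendre {0..\<mu>} g ((t - \<tau>) / x) + ?R \<tau>) \<and>
        U t x = (INF \<tau>. x * legendre {0..\<mu>} g ((t - \<tau>) / x) + Q \<tau>)"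
    if "viscosity_solution L \<mu> g ?R U" "x \<in> {0<..L}" for U t x
    using that unique[OF that(1), of x t]
    by (simp only: cost greaterThanAtMost_iff inf_convolution_released[OF Q]
        inf_convolution_arrivals[OF Q]) simp
  moreover have "legendre {0..\<mu>} g q = (if q \<le> 1 / V then 0 else (q - 1 / V) * \<mu>)" for q
    using legendre_linear[where g = g, OF \<mu> assms(8)] by (simp add: max_def)
  ultimately show ?thesis using sol unique by blast
qed

end
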